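(* Let $\mathcal{E}$ be a complete totally ordered family of partial isometries on a complex Hilbert space $H$, and let $$\mathcal{A}_{\mathcal{E}}=\{T\in B(H)\colon (I-Q_E)TP_E=0\text{ for all }E\in\mathcal{E}\}.$$ Let $x,y\in H$ be such that there exists $E_0\in\mathcal{E}$ with $y\in\operatorname{ran}(P_{E_0})$. The following assertions are equivalent. (i) There exists an operator $T\in\mathcal{A}_{\mathcal{E}}$ such that $T^*x=y$. (ii) $$K=\sup_{E\in\mathcal{E}}\frac{\|P_Ey\|}{\|Q_Ex\|}<\infty,$$ where the quotient is taken to be $0$ if $P_Ey=0=Q_Ex$, and $\infty$ if $P_Ey\neq0$ and $Q_Ex=0$. Under these conditions, $T$ can be chosen with $\|T\|=K$. Furthermore, if $S\in\mathcal{A}_{\mathcal{E}}$ is such that $S^*x=y$, then $\|S\|\ge K$.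
   Context: $B(H)$ is the set of bounded linear operators on $H$ and $I$ is the identity operator. A partial isometry is $V\in B(H)$ with $\|Vx\|=\|x\|$ for all $x\in\ker(V)^\perp$; its initial space is $\ker(V)^\perp$ and its final space is $\operatorname{ran}(V)$. $P_V=V^*V$ and $Q_V=VV^*$ are the orthogonal projections onto the initial and final spaces. Partial isometries are ordered by the Halmos--McLaughlin ordering: $E\le F$ if $F(x)=E(x)$ for all $x$ in the initial space of $E$ (so that the initial space of $E$ is contained in that of $F$). A family of partial isometries is complete if it contains $0$ and, for every nonempty subset of it, the supremum and infimum (in the poset of all partial isometries on $H$) exist and lie in the family. $\mathcal{A}_{\mathcal{E}}$ is not assumed here to be an algebra. *)

theory Defs
  imports "HOL-Analysis.Analysis"
begin

class complex_vector = real_vector +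
  fixes scaleC :: "complex \<Rightarrow> 'a \<Rightarrow> 'a"  (infixr "*\<^sub>C" 75)
  assumes scaleC_add_right: "a *\<^sub>C (x + y) = a *\<^sub>C x + a *\<^sub>C y"
    and scaleC_add_left: "(a + b) *\<^sub>C x = a *\<^sub>C x + b *\<^sub>C x"
    and scaleC_scaleC: "a *\<^sub>C (b *\<^sub>C x) = (a * b) *\<^sub>C x"
    and scaleC_one: "1 *\<^sub>C x = x"
    and scaleR_scaleC: "r *\<^sub>R x = complex_of_real r *\<^sub>C x"

class complex_inner = complex_vector + real_normed_vector +
  fixes cinner :: "'a \<Rightarrow> 'a \<Rightarrow> complex"
  assumes cinner_commute: "cinner x y = cnj (cinner y x)"
    and cinner_add_left: "cinner (x + y) z = cinner x z + cinner y z"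
    and cinner_scaleC_left: "cinner (a *\<^sub>C x) y = a * cinner x y"
    and cinner_ge_zero: "0 \<le> Re (cinner x x)"
    and cinner_eq_zero_iff: "cinner x x = 0 \<longleftrightarrow> x = 0"
    and norm_eq_sqrt_cinner: "norm x = sqrt (Re (cinner x x))"

class complex_hilbert = complex_inner + complete_space

text \<open>The type \<open>'a \<Rightarrow>\<^sub>L 'a\<close> consists of the bounded \<^emph>\<open>real\<close>-linear maps; \<open>BH\<close> singles out
  the complex-linear ones. The norm inherited from \<open>'a \<Rightarrow>\<^sub>L 'a\<close> is the usual operator norm.\<close>

definition BH :: "('a::complex_hilbert \<Rightarrow>\<^sub>L 'a) set" where
  "BH = {T. \<forall>c x. blinfun_apply T (c *\<^sub>C x) = c *\<^sub>C blinfun_apply T x}"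

text \<open>For \<open>T \<in> BH\<close> such an operator exists by the Riesz representation theorem; it is unique
  and again lies in \<open>BH\<close>.\<close>

definition adj :: "('a::complex_hilbert \<Rightarrow>\<^sub>L 'a) \<Rightarrow> ('a \<Rightarrow>\<^sub>L 'a)" where
  "adj T = (THE S. \<forall>x y. cinner (blinfun_apply T x) y = cinner x (blinfun_apply S y))"

definition ker_op :: "('a::complex_hilbert \<Rightarrow>\<^sub>L 'a) \<Rightarrow> 'a set" where
  "ker_op T = {x. blinfun_apply T x = 0}"

definition ortho_compl :: "'a::complex_hilbert set \<Rightarrow> 'a set" where
  "ortho_compl M = {x. \<forall>z\<in>M. cinner x z = 0}"

definition initial_space :: "('a::complex_hilbert \<Rightarrow>\<^sub>L 'a) \<Rightarrow> 'a set" where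
  "initial_space V = ortho_compl (ker_op V)"

definition partial_isometry :: "('a::complex_hilbert \<Rightarrow>\<^sub>L 'a) \<Rightarrow> bool" where
  "partial_isometry V \<longleftrightarrow>
     V \<in> BH \<and> (\<forall>x\<in>initial_space V. norm (blinfun_apply V x) = norm x)"

definition initial_proj :: "('a::complex_hilbert \<Rightarrow>\<^sub>L 'a) \<Rightarrow> ('a \<Rightarrow>\<^sub>L 'a)" where
  "initial_proj V = adj V o\<^sub>L V"

definition final_proj :: "('a::complex_hilbert \<Rightarrow>\<^sub>L 'a) \<Rightarrow> ('a \<Rightarrow>\<^sub>L 'a)" where
  "final_proj V = V o\<^sub>L adj V"

definition hm_le :: "('a::complex_hilbert \<Rightarrow>\<^sub>L 'a) \<Rightarrow> ('a \<Rightarrow>\<^sub>L 'a) \<Rightarrow> bool"  (infix "\<preceq>" 50) where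
  "E \<preceq> F \<longleftrightarrow> (\<forall>x\<in>initial_space E. blinfun_apply F x = blinfun_apply E x)"

text \<open>Suprema and infima are taken in the poset of all partial isometries on the space, not
  within a given family.\<close>

definition is_pi_sup :: "('a::complex_hilbert \<Rightarrow>\<^sub>L 'a) set \<Rightarrow> ('a \<Rightarrow>\<^sub>L 'a) \<Rightarrow> bool" where
  "is_pi_sup A G \<longleftrightarrow> partial_isometry G \<and> (\<forall>E\<in>A. E \<preceq> G) \<and>
     (\<forall>F. partial_isometry F \<longrightarrow> (\<forall>E\<in>A. E \<preceq> F) \<longrightarrow> G \<preceq> F)"

definition is_pi_inf :: "('a::complex_hilbert \<Rightarrow>\<^sub>L 'a) set \<Rightarrow> ('a \<Rightarrow>\<^sub>L 'a) \<Rightarrow> bool" where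
  "is_pi_inf A G \<longleftrightarrow> partial_isometry G \<and> (\<forall>E\<in>A. G \<preceq> E) \<and>
     (\<forall>F. partial_isometry F \<longrightarrow> (\<forall>E\<in>A. F \<preceq> E) \<longrightarrow> F \<preceq> G)"

definition complete_family :: "('a::complex_hilbert \<Rightarrow>\<^sub>L 'a) set \<Rightarrow> bool" where
  "complete_family \<E> \<longleftrightarrow> (\<forall>E\<in>\<E>. partial_isometry E) \<and> 0 \<in> \<E> \<and>
     (\<forall>A. A \<subseteq> \<E> \<longrightarrow> A \<noteq> {} \<longrightarrow>
        (\<exists>G\<in>\<E>. is_pi_sup A G) \<and> (\<exists>G\<in>\<E>. is_pi_inf A G))"

definition totally_ordered_family :: "('a::complex_hilbert \<Rightarrow>\<^sub>L 'a) set \<Rightarrow> bool" where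
  "totally_ordered_family \<E> \<longleftrightarrow> (\<forall>E\<in>\<E>. \<forall>F\<in>\<E>. E \<preceq> F \<or> F \<preceq> E)"

definition \<A> :: "('a::complex_hilbert \<Rightarrow>\<^sub>L 'a) set \<Rightarrow> ('a \<Rightarrow>\<^sub>L 'a) set" where
  "\<A> \<E> = {T \<in> BH. \<forall>E\<in>\<E>. (id_blinfun - final_proj E) o\<^sub>L T o\<^sub>L initial_proj E = 0}"

definition proj_quotient :: "'a::complex_hilbert \<Rightarrow> 'a \<Rightarrow> ('a \<Rightarrow>\<^sub>L 'a) \<Rightarrow> ennreal" where
  "proj_quotient x y E =
     (let p = blinfun_apply (initial_proj E) y; q = blinfun_apply (final_proj E) x in
      if q = 0 then (if p = 0 then 0 else \<infinity>) else ennreal (norm p / norm q))"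

definition interp_const :: "('a::complex_hilbert \<Rightarrow>\<^sub>L 'a) set \<Rightarrow> 'a \<Rightarrow> 'a \<Rightarrow> ennreal" where
  "interp_const \<E> x y = (SUP E\<in>\<E>. proj_quotient x y E)"

end

theory Submission
  imports Defs
begin

text \<open>
  Necessity is a direct estimate. If \<open>S\<close> is in \<open>\<A> \<E>\<close> and \<open>S* x = y\<close>, then \<open>S\<close> maps
  \<open>ran P\<^sub>E\<close> into \<open>ran Q\<^sub>E\<close>, so \<open>P\<^sub>E y = P\<^sub>E S* Q\<^sub>E x\<close> and hence
  \<open>\<parallel>P\<^sub>E y\<parallel> \<le> \<parallel>S\<parallel> \<parallel>Q\<^sub>E x\<parallel>\<close>.

  For sufficiency, replace \<open>x\<close> by \<open>K x\<close>, so that \<open>g E = \<parallel>P\<^sub>E y\<parallel>\<^sup>2\<close> is at most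
  \<open>f E = \<parallel>Q\<^sub>E x\<parallel>\<^sup>2\<close> for every \<open>E\<close>; what is needed is a contraction \<open>S\<close> with \<open>S x = y\<close> and
  \<open>P\<^sub>E S (I - Q\<^sub>E) = 0\<close> for all \<open>E\<close>, and then \<open>T = K S*\<close>. Since \<open>\<E>\<close> is a chain, the projections
  \<open>Q\<^sub>E\<close> form a chain too, so \<open>\<langle>Q\<^sub>E x, Q\<^sub>F x\<rangle> = min (f E) (f F)\<close>, which is the inner product in
  \<open>L\<^sup>2[0,\<infinity>)\<close> of the indicators of \<open>[0, f E]\<close> and \<open>[0, f F]\<close>. Thus \<open>Q\<^sub>E x \<mapsto> 1\<^bsub>[0, f E]\<^esub>\<close>
  extends to an isometry \<open>V\<close> of the closed span of the vectors \<open>Q\<^sub>E x\<close> into \<open>L\<^sup>2\<close>, and likewise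
  \<open>P\<^sub>E y \<mapsto> 1\<^bsub>[0, g E]\<^esub>\<close> extends to an isometry \<open>W\<close>. Both carry the given projections to
  multiplication by indicators of initial intervals. The operator is \<open>S = W* V\<close>, extended by \<open>0\<close>
  to the orthogonal complement of the domain of \<open>V\<close>. It is a contraction; it sends \<open>x\<close> to \<open>y\<close>
  because \<open>V x\<close> and \<open>W y\<close> are both \<open>1\<close> on \<open>[0, \<parallel>y\<parallel>\<^sup>2]\<close> and the range of \<open>W\<close> consists of functions
  supported there; and if \<open>Q\<^sub>E u = 0\<close> then \<open>V u\<close> vanishes on \<open>[0, f E]\<close>, which contains \<open>[0, g E]\<close>, so
  \<open>P\<^sub>E S u = 0\<close>. This is the continuous form of spreading the mass of \<open>x\<close> over that of \<open>y\<close> without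
  ever moving it backwards along the chain, and no limit over finite subchains is taken.

  The space \<open>L\<^sup>2\<close> enters only through the matrix entries
  \<open>\<langle>Q\<^sub>E x, S* P\<^sub>F y\<rangle> = min (f E) (g F)\<close>. Their form is bounded because \<open>min\<close> is a positive
  semidefinite kernel (\<open>min_gram_le\<close>); \<open>contraction_of_form\<close> turns a bounded form on two families of
  vectors into an operator; and \<open>causal_interpolation\<close> reads off the three properties of \<open>S\<close>.
  Adjoints, orthogonal projections and this operator all come from a single variational
  argument, \<open>riesz_on_combs\<close>.
\<close>

section \<open>Complex inner products\<close>

lemma cinner_zero_left [simp]: "cinner 0 (y::'a::complex_inner) = 0"
  using cinner_add_left[of 0 0 y] by simp

lemma cinner_add_right: "cinner (x::'a::complex_inner) (y + z) = cinner x y + cinner x z"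
  by (metis cinner_add_left cinner_commute complex_cnj_add)

lemma cinner_scaleC_right: "cinner (x::'a::complex_inner) (c *\<^sub>C y) = cnj c * cinner x y"
  by (metis cinner_commute cinner_scaleC_left complex_cnj_mult)

lemma cinner_scaleR_left: "cinner (r *\<^sub>R (x::'a::complex_inner)) y = of_real r * cinner x y"
  by (simp add: scaleR_scaleC cinner_scaleC_left)

lemma cinner_scaleR_right: "cinner (x::'a::complex_inner) (r *\<^sub>R y) = of_real r * cinner x y"
  by (simp add: scaleR_scaleC cinner_scaleC_right)

lemma cinner_zero_right [simp]: "cinner (x::'a::complex_inner) 0 = 0"
  by (metis cinner_commute cinner_zero_left complex_cnj_zero)

lemma cinner_minus_left [simp]: "cinner (- (x::'a::complex_inner)) y = - cinner x y"
  using cinner_scaleR_left[of "-1" x y] by simp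

lemma cinner_minus_right [simp]: "cinner (x::'a::complex_inner) (- y) = - cinner x y"
  using cinner_scaleR_right[of x "-1" y] by simp

lemma cinner_diff_left: "cinner ((x::'a::complex_inner) - y) z = cinner x z - cinner y z"
  using cinner_add_left[of x "-y" z] by simp

lemma cinner_diff_right: "cinner (x::'a::complex_inner) (y - z) = cinner x y - cinner x z"
  using cinner_add_right[of x y "-z"] by simp

lemmas cinner_simps =
  cinner_add_left cinner_add_right cinner_diff_left cinner_diff_right
  cinner_scaleC_left cinner_scaleC_right

lemma scaleC_zero_right [simp]: "c *\<^sub>C (0::'a::complex_vector) = 0"
  using scaleC_add_right[of c "0::'a" 0] by simp

lemma scaleC_diff_right: "c *\<^sub>C ((x::'a::complex_vector) - y) = c *\<^sub>C x - c *\<^sub>C y"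
  using scaleC_add_right[of c "x - y" y] by (simp add: algebra_simps)

lemma Re_cinner_commute: "Re (cinner (x::'a::complex_inner) y) = Re (cinner y x)"
  by (subst cinner_commute) simp

lemma Re_cinner_self: "Re (cinner (x::'a::complex_inner) x) = (norm x)\<^sup>2"
  by (simp add: norm_eq_sqrt_cinner cinner_ge_zero)

lemma cinner_self: "cinner (x::'a::complex_inner) x = of_real ((norm x)\<^sup>2)"
proof (rule complex_eqI)
  show "Im (cinner x x) = Im (of_real ((norm x)\<^sup>2))"
    using arg_cong[OF cinner_commute[of x x], of Im] by simp
qed (simp add: Re_cinner_self)

lemma norm_add_sq: "(norm ((x::'a::complex_inner) + y))\<^sup>2 = (norm x)\<^sup>2 + 2 * Re (cinner x y) + (norm y)\<^sup>2"
  unfolding Re_cinner_self[symmetric] using Re_cinner_commute[of x y] by (simp add: cinner_simps)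

lemma norm_diff_sq: "(norm ((x::'a::complex_inner) - y))\<^sup>2 = (norm x)\<^sup>2 - 2 * Re (cinner x y) + (norm y)\<^sup>2"
  using norm_add_sq[of x "-y"] by simp

lemma Re_cinner_le_squares: "2 * Re (cinner (x::'a::complex_inner) y) \<le> (norm x)\<^sup>2 + (norm y)\<^sup>2"
  using norm_diff_sq[of x y] zero_le_power2[of "norm (x - y)"] by linarith

lemma norm_scaleC [simp]: "norm (c *\<^sub>C (x::'a::complex_inner)) = cmod c * norm x"
proof -
  have "of_real ((norm (c *\<^sub>C x))\<^sup>2) = cinner (c *\<^sub>C x) (c *\<^sub>C x)"
    by (rule cinner_self[symmetric])
  also have "\<dots> = c * cnj c * cinner x x" by (simp add: cinner_simps)
  also have "\<dots> = of_real ((cmod c * norm x)\<^sup>2)"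
    by (simp add: cinner_self power_mult_distrib flip: complex_norm_square)
  finally have "(norm (c *\<^sub>C x))\<^sup>2 = (cmod c * norm x)\<^sup>2"
    using of_real_eq_iff by blast
  then show ?thesis by (simp add: power2_eq_iff_nonneg)
qed

lemma Re_cinner_le: "Re (cinner (x::'a::complex_inner) y) \<le> norm x * norm y"
proof (cases "x = 0 \<or> y = 0")
  case False
  then have pos: "norm x > 0" "norm y > 0" by auto
  have "2 * Re (cinner (norm y *\<^sub>R x) (norm x *\<^sub>R y)) \<le> 2 * (norm x * norm y)\<^sup>2"
    using Re_cinner_le_squares[of "norm y *\<^sub>R x" "norm x *\<^sub>R y"] by (simp add: algebra_simps)
  then have "(norm x * norm y) * Re (cinner x y) \<le> (norm x * norm y) * (norm x * norm y)"
    by (simp add: cinner_scaleR_left cinner_scaleR_right power2_eq_square mult.assoc mult.left_commute)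
  with pos show ?thesis by (simp add: mult_le_cancel_left)
qed auto

lemma norm_cinner_le: "cmod (cinner (x::'a::complex_inner) y) \<le> norm x * norm y"
proof (cases "cinner x y = 0")
  case False
  define c where "c = cnj (cinner x y) / cmod (cinner x y)"
  have c: "cmod c = 1" using False by (simp add: c_def norm_divide)
  have "cinner (c *\<^sub>C x) y = cmod (cinner x y)"
    using False complex_norm_square[of "cinner x y"]
    by (simp add: c_def cinner_scaleC_left field_simps power2_eq_square)
  then show ?thesis using Re_cinner_le[of "c *\<^sub>C x" y] c by simp
qed auto

lemma bounded_bilinear_cinner: "bounded_bilinear (cinner :: 'a::complex_inner \<Rightarrow> 'a \<Rightarrow> complex)"
proof (rule bounded_bilinear.intro)
  show "\<exists>K. \<forall>a b::'a. norm (cinner a b) \<le> norm a * norm b * K"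
    using norm_cinner_le by (intro exI[of _ 1]) auto
qed (auto simp: cinner_simps cinner_scaleR_left cinner_scaleR_right scaleR_conv_of_real)

lemmas tendsto_cinner [tendsto_intros] = bounded_bilinear.tendsto[OF bounded_bilinear_cinner]

lemma cinner_eqI:
  assumes "\<And>z. cinner z (u::'a::complex_inner) = cinner z v" shows "u = v"
  using assms[of "u - v"] cinner_eq_zero_iff[of "u - v"] by (simp add: cinner_diff_right)

section \<open>Finite linear combinations and the Riesz lemma\<close>

text \<open>Formal linear combinations are lists of coefficient-index pairs: sums become appended
  lists, so that linear spans of indexed families need no bookkeeping of supports.\<close>
definition comb :: "('i \<Rightarrow> 'a::complex_vector) \<Rightarrow> (complex \<times> 'i) list \<Rightarrow> 'a" where
  "comb a xs = (\<Sum>(c, i)\<leftarrow>xs. c *\<^sub>C a i)"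

definition indexed_by :: "'i set \<Rightarrow> (complex \<times> 'i) list \<Rightarrow> bool" where
  "indexed_by I xs \<longleftrightarrow> snd ` set xs \<subseteq> I"

definition combs :: "('i \<Rightarrow> 'a::complex_vector) \<Rightarrow> 'i set \<Rightarrow> 'a set" where
  "combs a I = comb a ` Collect (indexed_by I)"

definition scale_list :: "complex \<Rightarrow> (complex \<times> 'i) list \<Rightarrow> (complex \<times> 'i) list" where
  "scale_list c xs = map (\<lambda>(d, i). (c * d, i)) xs"

lemma comb_simps [simp]:
  "comb a [] = 0" "comb a ((c, i) # xs) = c *\<^sub>C a i + comb a xs" "comb a (xs @ ys) = comb a xs + comb a ys"
  by (simp_all add: comb_def)

lemma comb_scale_list [simp]: "comb a (scale_list c xs) = c *\<^sub>C comb a xs"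
  by (induction xs) (auto simp: scale_list_def scaleC_add_right scaleC_scaleC)

lemma indexed_by_simps [simp]:
  "indexed_by I []" "indexed_by I ((c, i) # xs) \<longleftrightarrow> i \<in> I \<and> indexed_by I xs"
  "indexed_by I (xs @ ys) \<longleftrightarrow> indexed_by I xs \<and> indexed_by I ys"
  "indexed_by I (scale_list c xs) \<longleftrightarrow> indexed_by I xs"
  by (auto simp: indexed_by_def scale_list_def image_image case_prod_beta)

text \<open>With \<open>\<complex>\<close> as a vector space over itself, \<open>comb p\<close> is the linear functional on formal
  combinations that takes the value \<open>p i\<close> at the index \<open>i\<close>.\<close>

instantiation complex :: complex_vector
begin
definition "scaleC_complex (c::complex) x = c * x"
instance by standard (auto simp: scaleC_complex_def algebra_simps scaleR_conv_of_real)
end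

text \<open>Riesz representation of a functional that is given only by its values \<open>p i\<close> on a spanning
  family \<open>a\<close>. The vector is the limit of a minimizing sequence of
  \<open>J = \<parallel>comb a xs\<parallel>\<^sup>2 - 2 Re (comb p xs)\<close>, which the hypothesis bounds from below; the parallelogram
  law makes the sequence Cauchy, and stationarity of the limit is the representation. By
  homogeneity the hypothesis is a bound on the norm of the functional, and it forces \<open>comb p xs\<close>
  to depend on \<open>comb a xs\<close> alone.\<close>

lemma riesz_on_combs:
  fixes a :: "'i \<Rightarrow> 'a::complex_hilbert" and p :: "'i \<Rightarrow> complex"
  assumes bound: "\<And>xs. indexed_by I xs \<Longrightarrow> 2 * Re (comb p xs) \<le> (norm (comb a xs))\<^sup>2 + C"
  shows "\<exists>z\<in>closure (combs a I). \<forall>i\<in>I. cinner (a i) z = p i"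
proof -
  define L where "L = Collect (indexed_by I)"
  define J where "J xs = (norm (comb a xs))\<^sup>2 - 2 * Re (comb p xs)" for xs
  define m where "m = Inf (J ` L)"
  have bdd: "bdd_below (J ` L)"
    using bound by (intro bdd_belowI[of _ "- C"]) (force simp: J_def L_def)
  have ne: "L \<noteq> {}" by (auto simp: L_def intro: exI[of _ "[]"])
  have m_le: "m \<le> J xs" if "xs \<in> L" for xs
    unfolding m_def using that bdd by (auto intro: cInf_lower)
  have "\<exists>xs\<in>L. J xs < m + 1 / Suc n" for n
    using cInf_lessD[of "J ` L" "m + 1 / Suc n"] ne by (auto simp: m_def)
  then have "\<forall>n. \<exists>xs. xs \<in> L \<and> J xs < m + 1 / Suc n" by blast
  then obtain X where X: "\<And>n. X n \<in> L" "\<And>n. J (X n) < m + 1 / Suc n" by (elim choice[THEN exE]) blast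
  have Jlim: "(\<lambda>n. J (X n)) \<longlonglongrightarrow> m"
  proof (rule tendsto_sandwich[of "\<lambda>_. m" _ _ "\<lambda>n. m + 1 / Suc n"])
    show "(\<lambda>n. m + 1 / Suc n) \<longlonglongrightarrow> m"
      using tendsto_add[OF tendsto_const LIMSEQ_inverse_real_of_nat, of m]
      by (simp add: inverse_eq_divide)
  qed (use m_le X in \<open>auto intro!: always_eventually less_imp_le\<close>)
  \<comment> \<open>Compare the infimum with the value of \<open>J\<close> at the midpoint.\<close>
  have par: "(norm (comb a xs - comb a ys))\<^sup>2 \<le> 2 * (J xs - m) + 2 * (J ys - m)"
    if "xs \<in> L" "ys \<in> L" for xs ys
  proof -
    have "m \<le> J (scale_list (1/2) xs @ scale_list (1/2) ys)"
      using that by (intro m_le) (auto simp: L_def)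
    also have "\<dots> = J xs / 2 + J ys / 2 - (norm (comb a xs - comb a ys))\<^sup>2 / 4"
    proof -
      have "comb a (scale_list (1/2) xs @ scale_list (1/2) ys) = (1/2) *\<^sub>C (comb a xs + comb a ys)"
        by (simp add: scaleC_add_right)
      then have "(norm (comb a (scale_list (1/2) xs @ scale_list (1/2) ys)))\<^sup>2
          = (norm (comb a xs + comb a ys))\<^sup>2 / 4"
        by (simp add: power_mult_distrib power_divide norm_divide)
      then show ?thesis
        unfolding J_def by (simp add: norm_add_sq norm_diff_sq scaleC_complex_def field_simps)
    qed
    finally show ?thesis by simp
  qed
  have "Cauchy (\<lambda>n. comb a (X n))"
  proof (rule metric_CauchyI)
    fix e :: real assume "e > 0"
    then have "\<forall>\<^sub>F n in sequentially. J (X n) < m + e\<^sup>2 / 4"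
      using Jlim by (intro order_tendstoD) auto
    then obtain N where N: "\<And>n. n \<ge> N \<Longrightarrow> J (X n) < m + e\<^sup>2 / 4"
      by (auto simp: eventually_sequentially)
    have "dist (comb a (X k)) (comb a (X n)) < e" if "k \<ge> N" "n \<ge> N" for k n
    proof -
      have "(norm (comb a (X k) - comb a (X n)))\<^sup>2 < e\<^sup>2"
        using par[OF X(1) X(1), of k n] N[OF that(1)] N[OF that(2)] by argo
      then show ?thesis using \<open>e > 0\<close> by (simp add: dist_norm power_less_imp_less_base)
    qed
    then show "\<exists>M. \<forall>k\<ge>M. \<forall>n\<ge>M. dist (comb a (X k)) (comb a (X n)) < e" by blast
  qed
  then obtain z where z: "(\<lambda>n. comb a (X n)) \<longlonglongrightarrow> z"
    using Cauchy_convergent convergent_def by blast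
  have stationary: "Re (cinner (comb a ys) z) = Re (comb p ys)" if ys: "ys \<in> L" for ys
  proof -
    define q where "q = 2 * (Re (cinner (comb a ys) z) - Re (comb p ys))"
    have "0 \<le> t * q + t\<^sup>2 * (norm (comb a ys))\<^sup>2" for t :: real
    proof -
      have "m \<le> J (X n) + t * (2 * (Re (cinner (comb a ys) (comb a (X n))) - Re (comb p ys)))
            + t\<^sup>2 * (norm (comb a ys))\<^sup>2" for n
      proof -
        have "m \<le> J (X n @ scale_list (of_real t) ys)"
          using X(1)[of n] ys by (intro m_le) (auto simp: L_def)
        also have "\<dots> = J (X n) + 2 * t * Re (cinner (comb a (X n)) (comb a ys))
            + t\<^sup>2 * (norm (comb a ys))\<^sup>2 - 2 * t * Re (comb p ys)"
          by (simp add: J_def norm_add_sq power_mult_distrib cinner_scaleC_right scaleC_complex_def)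
        finally show ?thesis
          unfolding Re_cinner_commute[of "comb a (X n)"] by (simp add: algebra_simps)
      qed
      moreover have "(\<lambda>n. J (X n) + t * (2 * (Re (cinner (comb a ys) (comb a (X n))) - Re (comb p ys)))
            + t\<^sup>2 * (norm (comb a ys))\<^sup>2) \<longlonglongrightarrow> m + t * q + t\<^sup>2 * (norm (comb a ys))\<^sup>2"
        unfolding q_def by (intro tendsto_intros Jlim z)
      ultimately have "m \<le> m + t * q + t\<^sup>2 * (norm (comb a ys))\<^sup>2"
        by (intro LIMSEQ_le_const) auto
      then show ?thesis by simp
    qed
    note * = this
    define N where "N = (norm (comb a ys))\<^sup>2 + 1"
    have N: "N > 0" "(norm (comb a ys))\<^sup>2 < N" by (auto simp: N_def add_nonneg_pos)
    \<comment> \<open>The parabola \<open>t q + t\<^sup>2 N\<close> vanishes at \<open>t = - q / N\<close>; as \<open>N\<close> exceeds the squared norm, the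
      nonnegative quantity in question would be negative there unless \<open>q = 0\<close>.\<close>
    have "q = 0"
    proof (rule ccontr)
      assume "q \<noteq> 0"
      have "0 \<le> (- q / N) * q + (- q / N)\<^sup>2 * (norm (comb a ys))\<^sup>2" by (rule *)
      also have "\<dots> < (- q / N) * q + (- q / N)\<^sup>2 * N"
        using N \<open>q \<noteq> 0\<close> by (intro add_strict_left_mono mult_strict_left_mono) auto
      also have "\<dots> = 0" using N by (simp add: power2_eq_square)
      finally show False by simp
    qed
    then show ?thesis by (simp add: q_def)
  qed
  show ?thesis
  proof (intro bexI[of _ z] ballI complex_eqI)
    fix i assume i: "i \<in> I"
    \<comment> \<open>The variational argument yields real parts; multiplying by \<open>\<i>\<close> recovers imaginary parts.\<close>
    have *: "Re (c * cinner (a i) z) = Re (c * p i)" for c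
      using stationary[of "[(c, i)]"] i by (auto simp: L_def cinner_simps scaleC_complex_def)
    show "Re (cinner (a i) z) = Re (p i)" using *[of 1] by simp
    show "Im (cinner (a i) z) = Im (p i)" using *[of "\<i>"] by simp
  next
    have "\<forall>n. comb a (X n) \<in> combs a I" using X(1) unfolding combs_def L_def by (intro allI imageI)
    then show "z \<in> closure (combs a I)" unfolding closure_sequential using z
      by (intro exI[of _ "\<lambda>n. comb a (X n)"] conjI)
  qed
qed

lemma comb_in_combs [intro]: "indexed_by I xs \<Longrightarrow> comb a xs \<in> combs a I"
  by (auto simp: combs_def)

lemma combsE:
  assumes "u \<in> combs a I" obtains xs where "indexed_by I xs" "u = comb a xs"
  using assms that by (auto simp: combs_def)

lemma closure_combs_combination:
  fixes a :: "'i \<Rightarrow> 'a::complex_inner"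
  assumes "u \<in> closure (combs a I)" "v \<in> closure (combs a I)"
  shows "u + c *\<^sub>C v \<in> closure (combs a I)"
proof -
  obtain U where U: "\<And>n. U n \<in> combs a I" "U \<longlonglongrightarrow> u"
    using assms(1) unfolding closure_sequential by blast
  obtain V where V: "\<And>n. V n \<in> combs a I" "V \<longlonglongrightarrow> v"
    using assms(2) unfolding closure_sequential by blast
  have lim: "(\<lambda>n. c *\<^sub>C V n) \<longlonglongrightarrow> c *\<^sub>C v"
  proof -
    have "(\<lambda>n. cmod c * norm (V n - v)) \<longlonglongrightarrow> cmod c * 0"
      using V(2) by (intro tendsto_intros) (simp add: LIM_zero tendsto_norm_zero)
    then have "(\<lambda>n. norm (c *\<^sub>C V n - c *\<^sub>C v)) \<longlonglongrightarrow> 0"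
      by (simp flip: scaleC_diff_right)
    then show ?thesis by (rule LIM_zero_cancel[OF tendsto_norm_zero_cancel])
  qed
  have "U n + c *\<^sub>C V n \<in> combs a I" for n
  proof -
    obtain xs where xs: "indexed_by I xs" "U n = comb a xs" using U(1)[of n] by (rule combsE)
    obtain ys where ys: "indexed_by I ys" "V n = comb a ys" using V(1)[of n] by (rule combsE)
    have "comb a (xs @ scale_list c ys) \<in> combs a I"
      using xs(1) ys(1) by (intro comb_in_combs) simp
    then show ?thesis by (simp add: xs ys)
  qed
  then show ?thesis
    unfolding closure_sequential using tendsto_add[OF U(2) lim]
    by (intro exI[of _ "\<lambda>n. U n + c *\<^sub>C V n"] conjI allI)
qed

lemma cinner_comb_left: "cinner (comb a xs) z = comb (\<lambda>i. cinner (a i) z) xs"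
  by (induction xs) (auto simp: cinner_simps scaleC_complex_def)

lemma comb_cong: "indexed_by I xs \<Longrightarrow> (\<And>i. i \<in> I \<Longrightarrow> a i = b i) \<Longrightarrow> comb a xs = comb b xs"
  by (induction xs) auto

text \<open>A vector in the closed span can be tested against itself: let the combinations converge
  to \<open>z\<close> in the hypothesis.\<close>

lemma norm_le_of_combs:
  fixes a :: "'i \<Rightarrow> 'a::complex_inner"
  assumes z: "z \<in> closure (combs a I)" and "C \<ge> 0"
    and le: "\<And>xs. indexed_by I xs \<Longrightarrow> Re (cinner (comb a xs) z) \<le> norm (comb a xs) * C"
  shows "norm z \<le> C"
proof -
  obtain U where U: "\<And>n. U n \<in> combs a I" "U \<longlonglongrightarrow> z"
    using z unfolding closure_sequential by blast
  have "Re (cinner (U n) z) \<le> norm (U n) * C" for n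
  proof -
    obtain xs where "indexed_by I xs" "U n = comb a xs"
      using U(1)[of n] by (rule combsE)
    then show ?thesis using le by metis
  qed
  moreover have "(\<lambda>n. Re (cinner (U n) z)) \<longlonglongrightarrow> Re (cinner z z)" "(\<lambda>n. norm (U n) * C) \<longlonglongrightarrow> norm z * C"
    using U(2) by (auto intro!: tendsto_intros)
  ultimately have "Re (cinner z z) \<le> norm z * C"
    using LIMSEQ_le by blast
  then have "norm z * norm z \<le> norm z * C" by (simp add: Re_cinner_self power2_eq_square)
  then show ?thesis using \<open>C \<ge> 0\<close> by (cases "z = 0") (auto simp: mult_le_cancel_left)
qed

lemma eq_zero_of_combs:
  fixes a :: "'i \<Rightarrow> 'a::complex_inner"
  assumes "z \<in> closure (combs a I)" "\<And>i. i \<in> I \<Longrightarrow> cinner (a i) z = 0"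
  shows "z = 0"
proof -
  have "comb (\<lambda>i. cinner (a i) z) xs = 0" if "indexed_by I xs" for xs
    using that assms(2) by (induction xs) auto
  then have "norm z \<le> 0"
    by (intro norm_le_of_combs[OF assms(1)]) (auto simp: cinner_comb_left)
  then show ?thesis by simp
qed

lemma combs_eqI:
  fixes a :: "'i \<Rightarrow> 'a::complex_inner"
  assumes "u \<in> closure (combs a I)" "v \<in> closure (combs a I)"
    "\<And>i. i \<in> I \<Longrightarrow> cinner (a i) u = cinner (a i) v"
  shows "u = v"
proof -
  have eq: "u - v = u + (-1) *\<^sub>C v" using scaleR_scaleC[of "-1" v] by simp
  have "u - v = 0"
  proof (rule eq_zero_of_combs)
    show "u - v \<in> closure (combs a I)"
      unfolding eq by (rule closure_combs_combination[OF assms(1,2)])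
    show "cinner (a i) (u - v) = 0" if "i \<in> I" for i
      using assms(3)[OF that] by (simp add: cinner_diff_right)
  qed
  then show ?thesis by simp
qed

section \<open>Adjoints\<close>

lemma BH_comb: "T \<in> BH \<Longrightarrow> blinfun_apply T (comb a xs) = comb (\<lambda>i. T (a i)) xs"
  by (induction xs) (auto simp: BH_def blinfun.add_right)

text \<open>The adjoint at \<open>y\<close> represents the functional \<open>u \<mapsto> \<langle>T u, y\<rangle>\<close>, with every vector of the
  space taken as its own index.\<close>

lemma adj_exists:
  fixes T :: "'a::complex_hilbert \<Rightarrow>\<^sub>L 'a"
  assumes T: "T \<in> BH"
  shows "\<exists>S. \<forall>x y. cinner (T x) y = cinner x (blinfun_apply S y)"
proof -
  have T_comb: "T (comb id xs) = comb T xs" for xs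
    using BH_comb[OF T, of id] by simp
  have "\<exists>z. \<forall>x. cinner x z = cinner (T x) y" for y
  proof -
    have "2 * Re (comb (\<lambda>u. cinner (T u) y) xs) \<le> (norm (comb id xs))\<^sup>2 + (norm T * norm y)\<^sup>2" for xs
    proof -
      have "Re (cinner (T (comb id xs)) y) \<le> norm (comb id xs) * (norm T * norm y)"
        by (rule order.trans[OF Re_cinner_le])
          (metis mult.assoc mult.commute mult_right_mono norm_blinfun norm_ge_zero)
      then show ?thesis
        using sum_squares_bound[of "norm (comb id xs)" "norm T * norm y"]
        by (simp add: T_comb cinner_comb_left)
    qed
    from riesz_on_combs[of UNIV "\<lambda>u. cinner (T u) y" id, OF this]
    show ?thesis by auto
  qed
  then obtain S where S: "\<And>x y. cinner x (S y) = cinner (T x) y" by metis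
  have "bounded_linear S"
  proof (rule bounded_linear_intro)
    show "S (x + y) = S x + S y" for x y by (rule cinner_eqI) (simp add: S cinner_simps)
    show "S (r *\<^sub>R x) = r *\<^sub>R S x" for r x by (rule cinner_eqI) (simp add: S cinner_scaleR_right)
    show "norm (S x) \<le> norm x * norm T" for x
    proof -
      have "norm (S x) * norm (S x) \<le> norm (T (S x)) * norm x"
        using Re_cinner_self[of "S x"] Re_cinner_le[of "T (S x)" x] by (simp add: S power2_eq_square)
      also have "\<dots> \<le> norm (S x) * (norm x * norm T)"
        using mult_right_mono[OF norm_blinfun[of T "S x"] norm_ge_zero[of x]] by (simp add: mult_ac)
      finally show ?thesis by (cases "S x = 0") (auto simp: mult_le_cancel_left)
    qed
  qed
  then show ?thesis using S bounded_linear_Blinfun_apply[of S] by (intro exI[of _ "Blinfun S"]) metis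
qed

lemma adj_eqI:
  assumes "\<And>x y. cinner (blinfun_apply T x) y = cinner x (blinfun_apply S y)" shows "adj T = S"
  unfolding adj_def
proof (rule the_equality)
  fix S' assume "\<forall>x y. cinner (T x) y = cinner x (blinfun_apply S' y)"
  then show "S' = S" using assms by (intro blinfun_eqI cinner_eqI) metis
qed (use assms in blast)

lemma cinner_adj_right: "T \<in> BH \<Longrightarrow> cinner x (adj T y) = cinner (T x) y"
  using adj_exists[of T] adj_eqI[of T] by metis

lemma cinner_adj_left: "T \<in> BH \<Longrightarrow> cinner (adj T x) y = cinner x (T y)"
  by (metis cinner_adj_right cinner_commute)

lemma adj_BH: "T \<in> BH \<Longrightarrow> adj T \<in> BH"
  unfolding BH_def mem_Collect_eq
  by (intro allI cinner_eqI) (simp add: cinner_adj_right cinner_simps BH_def)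

lemma adj_adj: "T \<in> BH \<Longrightarrow> adj (adj T) = T"
  by (rule adj_eqI) (rule cinner_adj_left)

lemma norm_adj_le: "T \<in> BH \<Longrightarrow> norm (adj T) \<le> norm T"
proof (rule norm_blinfun_bound)
  fix x assume T: "T \<in> BH"
  have "norm (adj T x) * norm (adj T x) \<le> norm (T (adj T x)) * norm x"
    using Re_cinner_self[of "adj T x"] Re_cinner_le[of "T (adj T x)" x]
    by (simp add: T cinner_adj_right power2_eq_square)
  also have "\<dots> \<le> norm (adj T x) * (norm T * norm x)"
    using mult_right_mono[OF norm_blinfun[of T "adj T x"] norm_ge_zero[of x]] by (simp add: mult_ac)
  finally show "norm (adj T x) \<le> norm T * norm x"
    by (cases "adj T x = 0") (auto simp: mult_le_cancel_left)
qed simp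

section \<open>Sesquilinear forms on two families of vectors\<close>

text \<open>The sesquilinear extension of the matrix \<open>k\<close> to formal combinations: the sum of
  \<open>c * cnj d * k i j\<close> over the entries \<open>(c, i)\<close> of \<open>xs\<close> and \<open>(d, j)\<close> of \<open>ys\<close>.\<close>

definition gram :: "('i \<Rightarrow> 'j \<Rightarrow> complex) \<Rightarrow> (complex \<times> 'i) list \<Rightarrow> (complex \<times> 'j) list \<Rightarrow> complex" where
  "gram k xs ys = comb (\<lambda>i. cnj (comb (\<lambda>j. cnj (k i j)) ys)) xs"

lemma cinner_comb_comb: "cinner (comb a xs) (comb b ys) = gram (\<lambda>i j. cinner (a i) (b j)) xs ys"
proof -
  have "cinner (a i) (comb b ys) = cnj (comb (\<lambda>j. cnj (cinner (a i) (b j))) ys)" for i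
  proof -
    have "cinner (a i) (comb b ys) = cnj (comb (\<lambda>j. cinner (b j) (a i)) ys)"
      by (subst cinner_commute) (simp add: cinner_comb_left)
    then show ?thesis by (simp flip: cinner_commute)
  qed
  then show ?thesis by (simp add: cinner_comb_left gram_def)
qed

lemma gram_cong:
  assumes "indexed_by I xs" "indexed_by J ys"
    "\<And>i j. i \<in> I \<Longrightarrow> j \<in> J \<Longrightarrow> k i j = k' i j"
  shows "gram k xs ys = gram k' xs ys"
  unfolding gram_def using assms
  by (intro comb_cong[OF assms(1)] arg_cong[of _ _ cnj] comb_cong[OF assms(2)]) auto

lemma has_bochner_integral_indicator_product:
  assumes "0 \<le> s" "0 \<le> t"
  shows "has_bochner_integral lborel (\<lambda>r. indicator {0..s} r * cnj (indicator {0..t} r))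
    (complex_of_real (min s t))"
proof -
  have "has_bochner_integral lborel (\<lambda>r. complex_of_real (indicator {0..min s t} r))
    (complex_of_real (measure lborel {0..min s t}))"
    by (intro has_bochner_integral_of_real has_bochner_integral_real_indicator) (auto simp: emeasure_lborel_Icc_eq)
  moreover have "complex_of_real (indicator {0..min s t} r) = indicator {0..s} r * cnj (indicator {0..t} r)" for r
    by (auto simp: indicator_def)
  ultimately show ?thesis using assms by simp
qed

text \<open>The kernel \<open>min (f i) (g j)\<close> is the matrix of inner products in \<open>L\<^sup>2\<close> of the indicators of
  \<open>{0..f i}\<close> and \<open>{0..g j}\<close>, so its form is the integral of a product of step functions.\<close>

lemma has_bochner_integral_min_gram:
  assumes "indexed_by I xs" "indexed_by J ys"
    and "\<And>i. i \<in> I \<Longrightarrow> 0 \<le> f i" "\<And>j. j \<in> J \<Longrightarrow> 0 \<le> g j"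
  shows "has_bochner_integral lborel
    (\<lambda>r. comb (\<lambda>i. indicator {0..f i} r) xs * cnj (comb (\<lambda>j. indicator {0..g j} r) ys))
    (gram (\<lambda>i j. complex_of_real (min (f i) (g j))) xs ys)"
  using assms(1)
proof (induction xs)
  case (Cons p xs)
  obtain c i where p: "p = (c, i)" "i \<in> I" using Cons by (cases p) auto
  have row: "has_bochner_integral lborel
      (\<lambda>r. indicator {0..f i} r * cnj (comb (\<lambda>j. indicator {0..g j} r) ys))
      (cnj (comb (\<lambda>j. cnj (complex_of_real (min (f i) (g j)))) ys))"
    using assms(2)
  proof (induction ys)
    case (Cons q ys)
    obtain d j where q: "q = (d, j)" "j \<in> J" using Cons by (cases q) auto
    show ?case
      using has_bochner_integral_add[OF
          has_bochner_integral_mult_right[OF has_bochner_integral_indicator_product[of "f i" "g j"], of "cnj d"]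
          Cons.IH] Cons.prems assms(3,4) p q
      by (simp add: scaleC_complex_def algebra_simps)
  qed (simp add: has_bochner_integral_zero)
  show ?case
    using has_bochner_integral_add[OF has_bochner_integral_mult_right[OF row, of c] Cons.IH] Cons.prems p
    by (simp add: scaleC_complex_def algebra_simps gram_def)
qed (simp add: has_bochner_integral_zero gram_def)

text \<open>This is \<open>2 Re \<langle>F, G\<rangle> \<le> \<parallel>F\<parallel>\<^sup>2 + \<parallel>G\<parallel>\<^sup>2\<close> for the step functions \<open>F\<close> and \<open>G\<close> in \<open>L\<^sup>2\<close> that
  the combinations represent. The additive form of the Cauchy-Schwarz inequality is convenient
  because it can be integrated pointwise and is what \<open>riesz_on_combs\<close> consumes.\<close>

lemma min_gram_le:
  assumes "indexed_by I xs" "indexed_by J ys"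
    and "\<And>i. i \<in> I \<Longrightarrow> 0 \<le> f i" "\<And>j. j \<in> J \<Longrightarrow> 0 \<le> g j"
  shows "2 * Re (gram (\<lambda>i j. complex_of_real (min (f i) (g j))) xs ys)
    \<le> Re (gram (\<lambda>i j. complex_of_real (min (f i) (f j))) xs xs)
      + Re (gram (\<lambda>i j. complex_of_real (min (g i) (g j))) ys ys)" (is "2 * Re ?xy \<le> Re ?xx + Re ?yy")
proof -
  define F where "F r = comb (\<lambda>i. indicator {0..f i} r :: complex) xs" for r
  define G where "G r = comb (\<lambda>j. indicator {0..g j} r :: complex) ys" for r
  note Re_integral = has_bochner_integral_bounded_linear[OF bounded_linear_Re has_bochner_integral_min_gram]
  have xy: "has_bochner_integral lborel (\<lambda>r. Re (F r * cnj (G r))) (Re ?xy)"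
    unfolding F_def G_def by (rule Re_integral[OF assms])
  have xx: "has_bochner_integral lborel (\<lambda>r. Re (F r * cnj (F r))) (Re ?xx)"
    unfolding F_def by (rule Re_integral[OF assms(1,1,3,3)])
  have yy: "has_bochner_integral lborel (\<lambda>r. Re (G r * cnj (G r))) (Re ?yy)"
    unfolding G_def by (rule Re_integral[OF assms(2,2,4,4)])
  have "2 * Re (F r * cnj (G r)) \<le> Re (F r * cnj (F r)) + Re (G r * cnj (G r))" for r
    using zero_le_power2[of "Re (F r) - Re (G r)"] zero_le_power2[of "Im (F r) - Im (G r)"]
    by (simp add: power2_eq_square algebra_simps)
  then have "(\<integral>r. 2 * Re (F r * cnj (G r)) \<partial>lborel)
      \<le> (\<integral>r. Re (F r * cnj (F r)) + Re (G r * cnj (G r)) \<partial>lborel)"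
    using xx yy xy
    by (intro integral_mono integrable_mult_right Bochner_Integration.integrable_add)
      (simp_all only: has_bochner_integral_iff)
  then show ?thesis
    using has_bochner_integral_mult_right[OF xy, of 2] has_bochner_integral_add[OF xx yy]
    by (simp only: has_bochner_integral_iff)
qed

text \<open>A form bounded by \<open>1\<close> on two spans is the matrix of a contraction. The vectors \<open>d j\<close> represent
  the functionals \<open>a i \<mapsto> k i j\<close>; the bound says that \<open>b j \<mapsto> d j\<close> extends to a linear contraction
  from the span of \<open>b\<close> to that of \<open>a\<close>, and \<open>S\<close> is the adjoint of its extension by \<open>0\<close>. Obtaining
  \<open>S\<close> from \<open>riesz_on_combs\<close> again, applied to \<open>b j \<mapsto> \<langle>d j, u\<rangle>\<close>, avoids extending that map
  by continuity.\<close>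

lemma contraction_of_form:
  fixes a :: "'i \<Rightarrow> 'a::complex_hilbert" and b :: "'j \<Rightarrow> 'a"
  assumes form: "\<And>(xs :: (complex \<times> 'i) list) (ys :: (complex \<times> 'j) list). indexed_by I xs \<Longrightarrow> indexed_by J ys \<Longrightarrow>
    2 * Re (gram k xs ys) \<le> (norm (comb a xs))\<^sup>2 + (norm (comb b ys))\<^sup>2"
  obtains S d where "S \<in> BH" "norm S \<le> 1"
    "\<And>j. j \<in> J \<Longrightarrow> d j \<in> closure (combs a I)"
    "\<And>i j. i \<in> I \<Longrightarrow> j \<in> J \<Longrightarrow> cinner (a i) (d j) = k i j"
    "\<And>u. blinfun_apply S u \<in> closure (combs b J)"
    "\<And>j u. j \<in> J \<Longrightarrow> cinner (b j) (blinfun_apply S u) = cinner (d j) u"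
proof -
  have "\<exists>z\<in>closure (combs a I). \<forall>i\<in>I. cinner (a i) z = k i j" if j: "j \<in> J" for j
  proof (rule riesz_on_combs)
    fix xs :: "(complex \<times> 'i) list" assume "indexed_by I xs"
    then show "2 * Re (comb (\<lambda>i. k i j) xs) \<le> (norm (comb a xs))\<^sup>2 + (norm (b j))\<^sup>2"
      using form[of xs "[(1, j)]"] j by (simp add: gram_def scaleC_one)
  qed
  then obtain d where d_in: "\<And>j. j \<in> J \<Longrightarrow> d j \<in> closure (combs a I)"
    and d: "\<And>i j. i \<in> I \<Longrightarrow> j \<in> J \<Longrightarrow> cinner (a i) (d j) = k i j"
    by metis
  have d_comb: "comb d ys \<in> closure (combs a I)" if "indexed_by J ys" for ys :: "(complex \<times> 'j) list"
    using that
  proof (induction ys)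
    case Nil
    have "0 = comb a []" by simp
    then have "0 \<in> combs a I" unfolding combs_def by (intro image_eqI[of _ _ "[]"]) auto
    then show ?case using closure_subset by auto
  next
    case (Cons p ys)
    then show ?case
      using closure_combs_combination[of "comb d ys" a I "d (snd p)" "fst p"] d_in
      by (cases p) (auto simp: add.commute)
  qed
  \<comment> \<open>Approximate \<open>w = comb d ys\<close> by combinations \<open>v\<close> of the \<open>a i\<close>: the form at \<open>v\<close> tends to
    \<open>\<parallel>w\<parallel>\<^sup>2\<close>, and the bound becomes \<open>2 \<parallel>w\<parallel>\<^sup>2 \<le> \<parallel>w\<parallel>\<^sup>2 + \<parallel>comb b ys\<parallel>\<^sup>2\<close>.\<close>
  have contr: "norm (comb d ys) \<le> norm (comb b ys)" if ys: "indexed_by J ys" for ys :: "(complex \<times> 'j) list"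
  proof -
    define w where "w = comb d ys"
    obtain U where U: "\<And>n. U n \<in> combs a I" "U \<longlonglongrightarrow> w"
      using d_comb[OF ys] unfolding closure_sequential w_def by blast
    have "2 * Re (cinner (U n) w) \<le> (norm (U n))\<^sup>2 + (norm (comb b ys))\<^sup>2" for n
    proof -
      obtain xs where xs: "indexed_by I xs" "U n = comb a xs"
        using U(1)[of n] by (rule combsE)
      have "cinner (U n) w = gram k xs ys"
        unfolding xs w_def cinner_comb_comb using d by (intro gram_cong[OF xs(1) ys]) auto
      then show ?thesis using form[OF xs(1) ys] xs by simp
    qed
    moreover have "(\<lambda>n. 2 * Re (cinner (U n) w)) \<longlonglongrightarrow> 2 * Re (cinner w w)"
      "(\<lambda>n. (norm (U n))\<^sup>2 + (norm (comb b ys))\<^sup>2) \<longlonglongrightarrow> (norm w)\<^sup>2 + (norm (comb b ys))\<^sup>2"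
      using U(2) by (auto intro!: tendsto_intros)
    ultimately have "2 * Re (cinner w w) \<le> (norm w)\<^sup>2 + (norm (comb b ys))\<^sup>2"
      using LIMSEQ_le by blast
    then show ?thesis by (simp add: Re_cinner_self w_def)
  qed
  have "\<exists>z\<in>closure (combs b J). \<forall>j\<in>J. cinner (b j) z = cinner (d j) u" for u
  proof (rule riesz_on_combs)
    fix ys :: "(complex \<times> 'j) list" assume ys: "indexed_by J ys"
    have "2 * Re (cinner (comb d ys) u) \<le> (norm (comb d ys))\<^sup>2 + (norm u)\<^sup>2" by (rule Re_cinner_le_squares)
    also have "\<dots> \<le> (norm (comb b ys))\<^sup>2 + (norm u)\<^sup>2" using contr[OF ys] by (simp add: power_mono)
    finally show "2 * Re (comb (\<lambda>j. cinner (d j) u) ys) \<le> (norm (comb b ys))\<^sup>2 + (norm u)\<^sup>2"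
      by (simp add: cinner_comb_left)
  qed
  then obtain S where S_in: "\<And>u. S u \<in> closure (combs b J)"
    and S: "\<And>j u. j \<in> J \<Longrightarrow> cinner (b j) (S u) = cinner (d j) u"
    by metis
  have S_lin: "S (u + c *\<^sub>C v) = S u + c *\<^sub>C S v" for u c v
    by (rule combs_eqI[OF S_in closure_combs_combination[OF S_in S_in]]) (simp add: S cinner_simps)
  have S_norm: "norm (S u) \<le> norm u" for u
  proof (rule norm_le_of_combs[OF S_in])
    fix ys :: "(complex \<times> 'j) list" assume ys: "indexed_by J ys"
    have "cinner (comb b ys) (S u) = cinner (comb d ys) u"
      unfolding cinner_comb_left using S by (intro comb_cong[OF ys]) auto
    then have "Re (cinner (comb b ys) (S u)) \<le> norm (comb d ys) * norm u"
      using Re_cinner_le by metis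
    also have "\<dots> \<le> norm (comb b ys) * norm u" using contr[OF ys] by (simp add: mult_right_mono)
    finally show "Re (cinner (comb b ys) (S u)) \<le> norm (comb b ys) * norm u" .
  qed simp
  have S_zero: "S 0 = 0" using S_norm[of 0] by simp
  have S_scale: "S (c *\<^sub>C u) = c *\<^sub>C S u" for c u using S_lin[of 0 c u] S_zero by simp
  have "bounded_linear S"
  proof (rule bounded_linear_intro[where K = 1])
    show "S (u + v) = S u + S v" for u v using S_lin[of u 1 v] by (simp add: scaleC_one)
  qed (use S_scale S_norm in \<open>auto simp: scaleR_scaleC\<close>)
  then have app: "blinfun_apply (Blinfun S) = S" by (rule bounded_linear_Blinfun_apply)
  show ?thesis
  proof (rule that[of "Blinfun S" d])
    show "norm (Blinfun S) \<le> 1" using S_norm by (intro norm_blinfun_bound) (auto simp: app)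
    show "Blinfun S \<in> BH" by (simp add: BH_def app S_scale)
  qed (simp_all only: app d_in d S_in S)
qed

lemma BH_maps_closure_combs:
  assumes "R \<in> BH" "\<And>k. k \<in> I \<Longrightarrow> blinfun_apply R (a k) \<in> a ` I" "u \<in> closure (combs a I)"
  shows "blinfun_apply R u \<in> closure (combs a I)"
proof -
  have "R (comb a xs) \<in> combs a I" if "indexed_by I xs" for xs
  proof -
    have "\<exists>ys. indexed_by I ys \<and> comb (\<lambda>k. R (a k)) xs = comb a ys"
      using that
    proof (induction xs)
      case Nil
      show ?case by (intro exI[of _ "[]"]) simp
    next
      case (Cons p xs)
      obtain c k where p: "p = (c, k)" "k \<in> I" using Cons.prems by (cases p) auto
      obtain l where "l \<in> I" "R (a k) = a l" using assms(2) p by blast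
      moreover obtain ys where "indexed_by I ys" "comb (\<lambda>k. R (a k)) xs = comb a ys"
        using Cons p by auto
      ultimately show ?case by (intro exI[of _ "(c, l) # ys"]) (simp add: p)
    qed
    then show ?thesis using comb_in_combs by (metis BH_comb[OF assms(1)])
  qed
  then have "R ` combs a I \<subseteq> combs a I" by (auto elim!: combsE)
  then have "R ` closure (combs a I) \<subseteq> closure (combs a I)"
    by (intro image_closure_subset continuous_intros) (auto intro: closure_subset[THEN subsetD])
  with assms(3) show ?thesis by blast
qed

section \<open>Comparable projections\<close>

definition orth_proj :: "('a::complex_hilbert \<Rightarrow>\<^sub>L 'a) \<Rightarrow> bool" where
  "orth_proj P \<longleftrightarrow> P \<in> BH \<and> P o\<^sub>L P = P \<and> (\<forall>u v. cinner (P u) v = cinner u (P v))"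

lemma
  assumes "orth_proj P"
  shows orth_proj_BH: "P \<in> BH"
    and orth_proj_idem: "P (P u) = P u"
    and orth_proj_sym: "cinner (P u) v = cinner u (P v)"
  using assms unfolding orth_proj_def by (auto dest: arg_cong[of _ _ "\<lambda>A. blinfun_apply A u"])

lemma orth_proj_compose_swap:
  assumes "orth_proj P" "orth_proj Q" "\<And>u. Q (P u) = P u"
  shows "P (blinfun_apply Q u) = P u"
  by (rule cinner_eqI) (metis assms orth_proj_sym)

lemma orth_proj_le_cinner:
  assumes "orth_proj P" "orth_proj Q" "\<And>u. Q (P u) = P u"
  shows "cinner (P x) (Q x) = of_real ((norm (blinfun_apply P x))\<^sup>2)"
  by (metis assms orth_proj_sym orth_proj_idem cinner_self)

lemma orth_proj_le_norm:
  assumes "orth_proj P" "orth_proj Q" "\<And>u. Q (P u) = P u"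
  shows "norm (P x) \<le> norm (blinfun_apply Q x)"
proof -
  have "norm (P x) * norm (P x) \<le> norm (P x) * norm (Q x)"
    using Re_cinner_le[of "P x" "Q x"] orth_proj_le_cinner[OF assms, of x] by (simp add: power2_eq_square)
  then show ?thesis by (cases "P x = 0") (auto simp: mult_le_cancel_left)
qed

text \<open>The inner product of two comparable projections of \<open>x\<close> is the squared norm of the smaller
  one. This is where the total ordering produces the kernel \<open>min\<close>.\<close>

lemma cinner_comparable_projections:
  assumes "orth_proj P" "orth_proj Q" "(\<forall>u. Q (P u) = P u) \<or> (\<forall>u. P (Q u) = Q u)"
  shows "cinner (P x) (Q x) = of_real (min ((norm (P x))\<^sup>2) ((norm (blinfun_apply Q x))\<^sup>2))"
  using assms(3)
proof
  assume *: "\<forall>u. Q (P u) = P u"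
  then have "norm (P x) \<le> norm (Q x)" using orth_proj_le_norm[OF assms(1,2)] by blast
  then show ?thesis using orth_proj_le_cinner[OF assms(1,2)] * by (simp add: min_absorb1 power_mono)
next
  assume *: "\<forall>u. P (Q u) = Q u"
  then have "norm (Q x) \<le> norm (P x)" using orth_proj_le_norm[OF assms(2,1)] by blast
  moreover have "cinner (P x) (Q x) = cinner (Q x) (P x)"
    using orth_proj_le_cinner[OF assms(2,1), of x] * cinner_commute[of "P x" "Q x"] by simp
  ultimately show ?thesis using orth_proj_le_cinner[OF assms(2,1)] * by (simp add: min_absorb2 power_mono)
qed

section \<open>Causal interpolation for two chains of projections\<close>

text \<open>The operator has matrix \<open>min (f i) (g j)\<close> with respect to \<open>Q i x\<close> and \<open>P j y\<close>. In the \<open>L\<^sup>2\<close>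
  picture, \<open>d j\<close> corresponds to the projection of the indicator of \<open>{0..g j}\<close> onto the closed span
  of the indicators of all \<open>{0..f i}\<close>, and \<open>Q i\<close> fixes it as soon as \<open>g j \<le> f i\<close>, because \<open>Q i\<close>
  acts as restriction to \<open>{0..f i}\<close>. With \<open>g i \<le> f i\<close> this gives
  \<open>Q i (d i) = d i\<close>, from which both \<open>S x = y\<close> and the annihilation property follow. The index
  \<open>i0\<close> serves to place \<open>y\<close> itself in the span of the \<open>P j y\<close>.\<close>

lemma causal_interpolation:
  fixes P Q :: "'i \<Rightarrow> ('a::complex_hilbert \<Rightarrow>\<^sub>L 'a)"
  assumes P: "\<And>i. i \<in> I \<Longrightarrow> orth_proj (P i)" and Q: "\<And>i. i \<in> I \<Longrightarrow> orth_proj (Q i)"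
    and chain: "\<And>i j. i \<in> I \<Longrightarrow> j \<in> I \<Longrightarrow>
      (\<forall>u. P j (P i u) = P i u) \<and> (\<forall>u. Q j (Q i u) = Q i u) \<or>
      (\<forall>u. P i (P j u) = P j u) \<and> (\<forall>u. Q i (Q j u) = Q j u)"
    and top: "i0 \<in> I" "P i0 y = y"
    and dom: "\<And>i. i \<in> I \<Longrightarrow> norm (P i y) \<le> norm (Q i x)"
  obtains S where "S \<in> BH" "norm S \<le> 1" "blinfun_apply S x = y"
    "\<And>i u. i \<in> I \<Longrightarrow> Q i u = 0 \<Longrightarrow> P i (blinfun_apply S u) = 0"
proof -
  define a where "a i = Q i x" for i
  define b where "b i = P i y" for i
  define f where "f i = (norm (a i))\<^sup>2" for i
  define g where "g i = (norm (b i))\<^sup>2" for i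
  have gf: "g i \<le> f i" if "i \<in> I" for i
    using dom[OF that] by (simp add: f_def g_def a_def b_def power_mono)
  have a_gram: "cinner (a i) (a j) = of_real (min (f i) (f j))" if "i \<in> I" "j \<in> I" for i j
    unfolding a_def f_def using cinner_comparable_projections[OF Q Q] chain that by blast
  have b_gram: "cinner (b i) (b j) = of_real (min (g i) (g j))" if "i \<in> I" "j \<in> I" for i j
    unfolding b_def g_def using cinner_comparable_projections[OF P P] chain that by blast
  have form: "2 * Re (gram (\<lambda>i j. of_real (min (f i) (g j))) xs ys)
      \<le> (norm (comb a xs))\<^sup>2 + (norm (comb b ys))\<^sup>2" if xs: "indexed_by I xs" and ys: "indexed_by I ys" for xs ys
  proof -
    have "gram (\<lambda>i j. of_real (min (f i) (f j))) xs xs = cinner (comb a xs) (comb a xs)"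
      unfolding cinner_comb_comb by (rule gram_cong[OF xs xs]) (simp add: a_gram)
    moreover have "gram (\<lambda>i j. of_real (min (g i) (g j))) ys ys = cinner (comb b ys) (comb b ys)"
      unfolding cinner_comb_comb by (rule gram_cong[OF ys ys]) (simp add: b_gram)
    ultimately show ?thesis
      using min_gram_le[OF xs ys, of f g] by (simp add: f_def g_def Re_cinner_self)
  qed
  obtain S d where S: "S \<in> BH" "norm S \<le> 1"
    and d_in: "\<And>j. j \<in> I \<Longrightarrow> d j \<in> closure (combs a I)"
    and d: "\<And>i j. i \<in> I \<Longrightarrow> j \<in> I \<Longrightarrow> cinner (a i) (d j) = of_real (min (f i) (g j))"
    and S_in: "\<And>u. blinfun_apply S u \<in> closure (combs b I)"
    and S_b: "\<And>j u. j \<in> I \<Longrightarrow> cinner (b j) (blinfun_apply S u) = cinner (d j) u"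
    by (rule contraction_of_form[of I I "\<lambda>i j. of_real (min (f i) (g j))" a b])
      (erule (1) form, rule that)
  \<comment> \<open>Each projection sends spanning vectors to spanning vectors, so it preserves the closed span.\<close>
  have Qa: "Q i (a k) = a k \<or> Q i (a k) = a i \<and> f i \<le> f k" if "i \<in> I" "k \<in> I" for i k
    using chain[OF that] orth_proj_compose_swap[OF Q Q, of i k] orth_proj_le_norm[OF Q Q, of i k] that
    by (auto simp: a_def f_def power_mono)
  have Pb: "P i (b k) = b k \<and> (\<forall>u. Q i (Q k u) = Q k u) \<or> P i (b k) = b i" if "i \<in> I" "k \<in> I" for i k
    using chain[OF that] orth_proj_compose_swap[OF P P, of i k] that
    by (auto simp: b_def)
  have d_fix: "Q i (d j) = d j" if i: "i \<in> I" and j: "j \<in> I" and le: "g j \<le> f i" for i j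
  proof (rule combs_eqI)
    show "Q i (d j) \<in> closure (combs a I)"
      using Qa[OF i] i by (intro BH_maps_closure_combs[OF orth_proj_BH[OF Q] _ d_in]) (auto simp: j)
    show "d j \<in> closure (combs a I)" by (rule d_in[OF j])
    show "cinner (a k) (Q i (d j)) = cinner (a k) (d j)" if k: "k \<in> I" for k
      using Qa[OF i k] d[OF i j] d[OF k j] le by (auto simp flip: orth_proj_sym[OF Q[OF i]] simp: min_absorb2)
  qed
  have d_fix_self: "Q i (d i) = d i" if "i \<in> I" for i
    using d_fix gf that by blast
  show ?thesis
  proof (rule that[OF S])
    show "S x = y"
    proof (rule combs_eqI[OF S_in])
      have "comb b [(1, i0)] \<in> combs b I" using top by (intro comb_in_combs) simp
      then show "y \<in> closure (combs b I)"
        using closure_subset top by (auto simp: b_def scaleC_one)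
      show "cinner (b j) (S x) = cinner (b j) y" if j: "j \<in> I" for j
      proof -
        have "cinner (b j) (S x) = cinner (d j) (a j)"
          using orth_proj_sym[OF Q[OF j], of "d j" x] d_fix_self[OF j] by (simp add: S_b j a_def)
        also have "\<dots> = of_real (g j)"
          using d[OF j j] gf[OF j] cinner_commute[of "d j" "a j"] by (simp add: min_absorb2)
        also have "\<dots> = cinner (b j) (b j)" by (simp add: cinner_self g_def)
        also have "\<dots> = cinner (b j) y"
          unfolding b_def using orth_proj_sym[OF P[OF j], of "P j y" y] orth_proj_idem[OF P[OF j]] by simp
        finally show ?thesis .
      qed
    qed
    show "P i (S u) = 0" if i: "i \<in> I" and u: "Q i u = 0" for i u
    proof (rule eq_zero_of_combs)
      show "P i (S u) \<in> closure (combs b I)"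
        using Pb[OF i] i by (intro BH_maps_closure_combs[OF orth_proj_BH[OF P] _ S_in]) auto
      have vanish: "cinner (d k) u = 0" if k: "k \<in> I" and "Q i (d k) = d k" for k
        using orth_proj_sym[OF Q[OF i], of "d k" u] that u by simp
      show "cinner (b k) (P i (S u)) = 0" if k: "k \<in> I" for k
      proof -
        \<comment> \<open>\<open>P i (b k)\<close> is \<open>b k\<close> or \<open>b i\<close>, according to which index is smaller; in both cases the
          matching \<open>d\<close> lies in the range of \<open>Q i\<close> and is orthogonal to \<open>u\<close>.\<close>
        have "Q i (d k) = d k" if "\<forall>u. Q i (Q k u) = Q k u" using that d_fix_self[OF k] by metis
        then show ?thesis
          using Pb[OF i k] vanish[OF k] vanish[OF i d_fix_self[OF i]] S_b[OF k] S_b[OF i]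
          by (auto simp flip: orth_proj_sym[OF P[OF i]])
      qed
    qed
  qed
qed

section \<open>Partial isometries and the Halmos--McLaughlin order\<close>

text \<open>Orthogonal projection onto the kernel, obtained by representing \<open>m \<mapsto> \<langle>m, v\<rangle>\<close> there.\<close>

lemma ker_decomposition:
  assumes "V \<in> BH"
  obtains k where "k \<in> ker_op V" "v - k \<in> initial_space V"
proof -
  have "\<exists>z\<in>closure (combs id (ker_op V)). \<forall>m\<in>ker_op V. cinner (id m) z = cinner m v"
  proof (rule riesz_on_combs)
    fix xs :: "(complex \<times> 'a) list"
    show "2 * Re (comb (\<lambda>m. cinner m v) xs) \<le> (norm (comb id xs))\<^sup>2 + (norm v)\<^sup>2"
      using Re_cinner_le_squares[of "comb id xs" v] by (simp add: cinner_comb_left)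
  qed
  then obtain z where z: "z \<in> closure (combs id (ker_op V))" "\<And>m. m \<in> ker_op V \<Longrightarrow> cinner m z = cinner m v"
    by auto
  have "V (comb id xs) = 0" if "indexed_by (ker_op V) xs" for xs
    using that assms by (induction xs) (auto simp: ker_op_def BH_def blinfun.add_right)
  then have "combs id (ker_op V) \<subseteq> ker_op V" by (auto simp: ker_op_def elim!: combsE)
  moreover have "closed (ker_op V)"
    unfolding ker_op_def by (intro closed_Collect_eq continuous_intros)
  ultimately have "z \<in> ker_op V" using z(1) closure_minimal by blast
  moreover have "cinner (v - z) m = 0" if "m \<in> ker_op V" for m
    using z(2)[OF that] by (metis cinner_commute cinner_diff_left diff_self)
  ultimately show ?thesis using that by (auto simp: initial_space_def ortho_compl_def)
qed

text \<open>Polarization: applied to \<open>z + y\<close> it gives real parts, and replacing \<open>x\<close> by \<open>\<i> x\<close> gives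
  imaginary parts.\<close>

lemma partial_isometry_cinner:
  assumes V: "partial_isometry V" and x: "x \<in> initial_space V" and y: "y \<in> initial_space V"
  shows "cinner (V x) (blinfun_apply V y) = cinner x y"
proof -
  have VB: "V \<in> BH" using V by (simp add: partial_isometry_def)
  have iso: "norm (V z) = norm z" if "z \<in> initial_space V" for z
    using V that by (simp add: partial_isometry_def)
  have re: "Re (cinner (V z) (V y)) = Re (cinner z y)" if z: "z \<in> initial_space V" for z
  proof -
    have "z + y \<in> initial_space V"
      using z y by (simp add: initial_space_def ortho_compl_def cinner_add_left)
    then show ?thesis
      using iso[of "z + y"] iso[OF z] iso[OF y] norm_add_sq[of z y] norm_add_sq[of "V z" "V y"]
      by (simp add: blinfun.add_right)
  qed
  have "\<i> *\<^sub>C x \<in> initial_space V"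
    using x by (simp add: initial_space_def ortho_compl_def cinner_scaleC_left)
  from re[OF this] have "Im (cinner (V x) (V y)) = Im (cinner x y)"
    using VB by (simp add: BH_def cinner_scaleC_left)
  with re[OF x] show ?thesis by (simp add: complex_eq_iff)
qed

lemma initial_proj_apply: "initial_proj V u = adj V (blinfun_apply V u)"
  by (simp add: initial_proj_def)

lemma final_proj_apply: "final_proj V u = V (blinfun_apply (adj V) u)"
  by (simp add: final_proj_def)

lemma initial_proj_fix:
  assumes V: "partial_isometry V" and m: "m \<in> initial_space V"
  shows "initial_proj V m = m"
proof (rule cinner_eqI)
  fix w
  have VB: "V \<in> BH" using V by (simp add: partial_isometry_def)
  obtain k where k: "k \<in> ker_op V" "w - k \<in> initial_space V" using ker_decomposition[OF VB] .
  have "cinner m k = 0" using m k by (simp add: initial_space_def ortho_compl_def)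
  then have km: "cinner k m = 0" using cinner_commute[of k m] by simp
  have "cinner w (initial_proj V m) = cinner (V w) (V m)" by (simp add: initial_proj_apply cinner_adj_right VB)
  also have "V w = V (w - k)" using k by (simp add: ker_op_def blinfun.diff_right)
  also have "cinner \<dots> (V m) = cinner w m"
    using partial_isometry_cinner[OF V k(2) m] km by (simp add: cinner_diff_left)
  finally show "cinner w (initial_proj V m) = cinner w m" .
qed

lemma initial_proj_in:
  assumes V: "partial_isometry V" shows "initial_proj V u \<in> initial_space V"
proof -
  have VB: "V \<in> BH" using V by (simp add: partial_isometry_def)
  obtain k where k: "k \<in> ker_op V" "u - k \<in> initial_space V" using ker_decomposition[OF VB] .
  have "initial_proj V u = initial_proj V (u - k)"
    using k by (simp add: initial_proj_apply ker_op_def blinfun.diff_right)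
  then show ?thesis using k initial_proj_fix[OF V k(2)] by simp
qed

lemma partial_isometry_initial_proj:
  assumes V: "partial_isometry V" shows "V (initial_proj V u) = V u"
proof -
  have VB: "V \<in> BH" using V by (simp add: partial_isometry_def)
  obtain k where k: "k \<in> ker_op V" "u - k \<in> initial_space V" using ker_decomposition[OF VB] .
  have "initial_proj V u = initial_proj V (u - k)"
    using k by (simp add: initial_proj_apply ker_op_def blinfun.diff_right)
  then show ?thesis using k initial_proj_fix[OF V k(2)] by (simp add: ker_op_def blinfun.diff_right)
qed

lemma BH_compose: "S \<in> BH \<Longrightarrow> T \<in> BH \<Longrightarrow> S o\<^sub>L T \<in> BH"
  by (simp add: BH_def)

lemma orth_proj_initial_proj:
  assumes V: "partial_isometry V" shows "orth_proj (initial_proj V)"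
proof -
  have VB: "V \<in> BH" using V by (simp add: partial_isometry_def)
  show ?thesis
    unfolding orth_proj_def
  proof (intro conjI allI)
    show "initial_proj V o\<^sub>L initial_proj V = initial_proj V"
      by (rule blinfun_eqI) (simp add: initial_proj_fix[OF V] initial_proj_in[OF V])
  qed (simp_all add: initial_proj_def BH_compose VB adj_BH cinner_adj_left cinner_adj_right)
qed

lemma orth_proj_final_proj:
  assumes V: "partial_isometry V" shows "orth_proj (final_proj V)"
proof -
  have VB: "V \<in> BH" using V by (simp add: partial_isometry_def)
  show ?thesis
    unfolding orth_proj_def
  proof (intro conjI allI)
    show "final_proj V o\<^sub>L final_proj V = final_proj V"
      using partial_isometry_initial_proj[OF V]
      by (intro blinfun_eqI) (simp add: final_proj_apply initial_proj_apply)
  qed (simp_all add: final_proj_def BH_compose VB adj_BH adj_adj cinner_adj_left flip: cinner_adj_right)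
qed

text \<open>On the initial space of \<open>E\<close>, \<open>F\<close> agrees with \<open>E\<close> and so preserves norms; since \<open>F v\<close> is \<open>F\<close>
  of the projection of \<open>v\<close>, the projection onto the initial space of \<open>F\<close> preserves the norm of \<open>v\<close>,
  and a projection that does so fixes \<open>v\<close>. The ranges are then nested because \<open>E E* = F E*\<close>.\<close>

lemma hm_le_projections:
  assumes E: "partial_isometry E" and F: "partial_isometry F" and le: "E \<preceq> F"
  shows "initial_proj F (initial_proj E u) = initial_proj E u"
    and "final_proj F (final_proj E u) = final_proj E u"
proof -
  have EB: "E \<in> BH" and FB: "F \<in> BH" using E F by (simp_all add: partial_isometry_def)
  have initial_fix: "initial_proj F v = v" if v: "v \<in> initial_space E" for v
  proof -
    let ?w = "initial_proj F v"
    have "norm ?w = norm (F ?w)"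
      using F initial_proj_in[OF F] by (simp add: partial_isometry_def)
    also have "\<dots> = norm v"
      using partial_isometry_initial_proj[OF F] le v E by (simp add: hm_le_def partial_isometry_def)
    finally have norm: "norm ?w = norm v" .
    have "Re (cinner v ?w) = (norm ?w)\<^sup>2"
      using orth_proj_sym[OF orth_proj_initial_proj[OF F], of v ?w]
        orth_proj_idem[OF orth_proj_initial_proj[OF F], of v] Re_cinner_self[of ?w] by simp
    then have "(norm (v - ?w))\<^sup>2 = 0" by (simp add: norm_diff_sq norm)
    then show ?thesis by simp
  qed
  from initial_fix show "initial_proj F (initial_proj E u) = initial_proj E u"
    using initial_proj_in[OF E] by blast
  have FE: "F (initial_proj E v) = E v" for v
    using le initial_proj_in[OF E] partial_isometry_initial_proj[OF E] by (simp add: hm_le_def)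
  have adj_E: "initial_proj E (adj E u) = adj E u"
    by (rule cinner_eqI)
      (metis EB E cinner_adj_right orth_proj_sym[OF orth_proj_initial_proj[OF E]] partial_isometry_initial_proj)
  have "final_proj E u = F (adj E u)"
    using FE[of "adj E u"] adj_E by (simp add: final_proj_apply)
  moreover have "F (adj F (F (adj E u))) = F (adj E u)"
    using partial_isometry_initial_proj[OF F, of "adj E u"] by (simp add: initial_proj_apply)
  ultimately show "final_proj F (final_proj E u) = final_proj E u"
    by (simp add: final_proj_apply)
qed

section \<open>The interpolation constant\<close>

text \<open>The conventions for a vanishing denominator are exactly those that make the bound on the
  quotient equivalent to the product inequality.\<close>

lemma proj_quotient_le_iff:
  assumes "0 \<le> k"
  shows "proj_quotient x y E \<le> ennreal k \<longleftrightarrow> norm (initial_proj E y) \<le> k * norm (final_proj E x)"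
  using assms by (auto simp: proj_quotient_def Let_def divide_le_eq ennreal_le_iff top_unique)

lemma interp_const_le_iff:
  assumes "0 \<le> k"
  shows "interp_const \<E> x y \<le> ennreal k \<longleftrightarrow>
    (\<forall>E\<in>\<E>. norm (initial_proj E y) \<le> k * norm (final_proj E x))"
  by (simp add: interp_const_def SUP_le_iff proj_quotient_le_iff[OF assms])

lemma interp_const_le_norm:
  assumes pi: "\<And>E. E \<in> \<E> \<Longrightarrow> partial_isometry E" and S: "S \<in> \<A> \<E>" and y: "adj S x = y"
  shows "interp_const \<E> x y \<le> ennreal (norm S)"
  unfolding interp_const_le_iff[OF norm_ge_zero]
proof
  fix E assume E: "E \<in> \<E>"
  have SB: "S \<in> BH" using S by (simp add: \<A>_def)
  define p where "p = initial_proj E y"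
  have pp: "initial_proj E p = p"
    unfolding p_def by (rule orth_proj_idem[OF orth_proj_initial_proj[OF pi[OF E]]])
  have "((id_blinfun - final_proj E) o\<^sub>L S o\<^sub>L initial_proj E) p = 0"
    using S E by (simp add: \<A>_def)
  then have Sp: "S p = final_proj E (S p)" by (simp add: blinfun.diff_left pp)
  have "(norm p)\<^sup>2 = Re (cinner p y)"
    using orth_proj_sym[OF orth_proj_initial_proj[OF pi[OF E]], of p y] by (simp add: pp p_def[symmetric] Re_cinner_self)
  also have "cinner p y = cinner (S p) x" unfolding y[symmetric] by (rule cinner_adj_right[OF SB])
  also have "\<dots> = cinner (S p) (final_proj E x)"
    by (subst Sp) (rule orth_proj_sym[OF orth_proj_final_proj[OF pi[OF E]]])
  also have "Re \<dots> \<le> (norm S * norm p) * norm (final_proj E x)"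
    by (rule order.trans[OF Re_cinner_le]) (intro mult_right_mono norm_blinfun norm_ge_zero)
  finally have "norm p * norm p \<le> norm p * (norm S * norm (final_proj E x))"
    by (simp add: power2_eq_square mult_ac)
  then show "norm (initial_proj E y) \<le> norm S * norm (final_proj E x)"
    unfolding p_def[symmetric] by (cases "p = 0") (auto simp: mult_le_cancel_left)
qed

text \<open>The condition \<open>(I - Q\<^sub>E) S* P\<^sub>E = 0\<close> is the adjoint of \<open>P\<^sub>E S (I - Q\<^sub>E) = 0\<close>, and \<open>I - Q\<^sub>E\<close> maps
  onto the kernel of \<open>Q\<^sub>E\<close>.\<close>

lemma scaled_adjoint_causal:
  assumes pi: "\<And>E. E \<in> \<E> \<Longrightarrow> partial_isometry E" and S: "S \<in> BH"
    and causal: "\<And>E u. E \<in> \<E> \<Longrightarrow> final_proj E u = 0 \<Longrightarrow> initial_proj E (blinfun_apply S u) = 0"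
  shows "r *\<^sub>R adj S \<in> \<A> \<E>" and "adj (r *\<^sub>R adj S) = r *\<^sub>R S"
proof -
  have "r *\<^sub>R adj S \<in> BH"
    using adj_BH[OF S] by (simp add: BH_def blinfun.scaleR_left scaleR_scaleC scaleC_scaleC mult.commute)
  moreover have "(id_blinfun - final_proj E) o\<^sub>L (r *\<^sub>R adj S) o\<^sub>L initial_proj E = 0" if E: "E \<in> \<E>" for E
  proof (intro blinfun_eqI cinner_eqI)
    fix v u
    note P = orth_proj_initial_proj[OF pi[OF E]] and Q = orth_proj_final_proj[OF pi[OF E]]
    define w where "w = u - final_proj E u"
    have "final_proj E w = 0" by (simp add: w_def blinfun.diff_right orth_proj_idem[OF Q])
    then have "initial_proj E (S w) = 0" using causal E by blast
    then have "cinner w (adj S (initial_proj E v)) = 0"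
      using orth_proj_sym[OF P, of "S w" v] by (simp add: cinner_adj_right S)
    then have "cinner u (adj S (initial_proj E v)) - cinner u (final_proj E (adj S (initial_proj E v))) = 0"
      by (simp add: w_def cinner_diff_left orth_proj_sym[OF Q])
    then show "cinner u (((id_blinfun - final_proj E) o\<^sub>L (r *\<^sub>R adj S) o\<^sub>L initial_proj E) v)
        = cinner u (blinfun_apply 0 v)"
      by (simp add: blinfun.diff_left blinfun.scaleR_left blinfun.scaleR_right cinner_diff_right
          cinner_scaleR_right flip: right_diff_distrib)
  qed
  ultimately show "r *\<^sub>R adj S \<in> \<A> \<E>" by (simp add: \<A>_def)
  show "adj (r *\<^sub>R adj S) = r *\<^sub>R S"
    by (rule adj_eqI) (simp add: blinfun.scaleR_left cinner_scaleR_left cinner_scaleR_right cinner_adj_left S)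
qed

text \<open>Interpolating \<open>k x\<close> by a contraction and rescaling afterwards also covers \<open>k = 0\<close>, where the
  domination of \<open>P\<^sub>E y\<close> forces \<open>y = 0\<close>.\<close>

lemma interpolating_operator:
  assumes pi: "\<And>E. E \<in> \<E> \<Longrightarrow> partial_isometry E" and chain: "totally_ordered_family \<E>"
    and y: "E0 \<in> \<E>" "y \<in> range (blinfun_apply (initial_proj E0))" and fin: "interp_const \<E> x y < \<infinity>"
  obtains T where "T \<in> \<A> \<E>" "adj T x = y" "ennreal (norm T) \<le> interp_const \<E> x y"
proof -
  obtain k where k: "interp_const \<E> x y = ennreal k" "0 \<le> k"
    using fin by (cases "interp_const \<E> x y") auto
  have dom: "norm (initial_proj E y) \<le> norm (final_proj E (k *\<^sub>R x))" if "E \<in> \<E>" for E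
    using interp_const_le_iff[OF k(2), of \<E> x y] k that by (simp add: blinfun.scaleR_right)
  have "initial_proj E0 y = y"
    using y orth_proj_idem[OF orth_proj_initial_proj[OF pi[OF y(1)]]] by auto
  moreover have "(\<forall>u. initial_proj F (initial_proj E u) = initial_proj E u) \<and>
        (\<forall>u. final_proj F (final_proj E u) = final_proj E u) \<or>
      (\<forall>u. initial_proj E (initial_proj F u) = initial_proj F u) \<and>
        (\<forall>u. final_proj E (final_proj F u) = final_proj F u)" if "E \<in> \<E>" "F \<in> \<E>" for E F
    using chain that hm_le_projections[OF pi pi] unfolding totally_ordered_family_def by blast
  ultimately
  obtain S where S: "S \<in> BH" "norm S \<le> 1" "S (k *\<^sub>R x) = y"
    "\<And>E u. E \<in> \<E> \<Longrightarrow> final_proj E u = 0 \<Longrightarrow> initial_proj E (blinfun_apply S u) = 0"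
    using causal_interpolation[of \<E> initial_proj final_proj E0 y "k *\<^sub>R x"]
      orth_proj_initial_proj[OF pi] orth_proj_final_proj[OF pi] y(1) dom by blast
  show ?thesis
  proof (rule that)
    show "k *\<^sub>R adj S \<in> \<A> \<E>" by (rule scaled_adjoint_causal[OF pi S(1,4)])
    show "adj (k *\<^sub>R adj S) x = y"
      using S(3) by (simp add: scaled_adjoint_causal(2)[OF pi S(1,4)] blinfun.scaleR_left blinfun.scaleR_right)
    have "norm (adj S) \<le> 1" using norm_adj_le[OF S(1)] S(2) by linarith
    then show "ennreal (norm (k *\<^sub>R adj S)) \<le> interp_const \<E> x y"
      using k mult_left_mono[of "norm (adj S)" 1 k] by (simp add: ennreal_leI)
  qed
qed

theorem theorem4p5:
  fixes \<E> :: "('a::complex_hilbert \<Rightarrow>\<^sub>L 'a) set" and x y :: 'a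
  assumes "complete_family \<E>"
    and "totally_ordered_family \<E>"
    and "\<exists>E\<^sub>0\<in>\<E>. y \<in> range (blinfun_apply (initial_proj E\<^sub>0))"
  shows "((\<exists>T\<in>\<A> \<E>. blinfun_apply (adj T) x = y) \<longleftrightarrow> interp_const \<E> x y < \<infinity>)
    \<and> (interp_const \<E> x y < \<infinity> \<longrightarrow>
        (\<exists>T\<in>\<A> \<E>. blinfun_apply (adj T) x = y \<and> ennreal (norm T) = interp_const \<E> x y))
    \<and> (\<forall>S\<in>\<A> \<E>. blinfun_apply (adj S) x = y \<longrightarrow> ennreal (norm S) \<ge> interp_const \<E> x y)"
proof -
  have pi: "partial_isometry E" if "E \<in> \<E>" for E
    using assms(1) that by (simp add: complete_family_def)
  have lower: "interp_const \<E> x y \<le> ennreal (norm S)" if "S \<in> \<A> \<E>" "adj S x = y" for S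
    using interp_const_le_norm[OF pi] that by blast
  have attained: "\<exists>T\<in>\<A> \<E>. adj T x = y \<and> ennreal (norm T) = interp_const \<E> x y"
    if fin: "interp_const \<E> x y < \<infinity>"
  proof -
    obtain E0 where "E0 \<in> \<E>" "y \<in> range (blinfun_apply (initial_proj E0))" using assms(3) by blast
    then obtain T where "T \<in> \<A> \<E>" "adj T x = y" "ennreal (norm T) \<le> interp_const \<E> x y"
      using interpolating_operator[of \<E> E0 y x] pi assms(2) fin by blast
    then show ?thesis using lower by (intro bexI[of _ T] conjI order.antisym)
  qed
  have "interp_const \<E> x y < \<infinity>" if "T \<in> \<A> \<E>" "adj T x = y" for T
    using lower[OF that] by (simp add: le_less_trans[OF _ ennreal_less_top])
  with attained lower show ?thesis by blast
qed

end
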